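(* Suppose that the i.i.d. random embeddings $S_0,S_1,\dots\in\mathbb{R}^{m\times n}$ satisfy the first and second inverse unbiased moments condition, with constants $\theta_1,\theta_2>0$. Then the iterates $\{x_t\}$ of the iterative Hessian sketch (IHS) $x_{t+1}=x_t-\mu_t H_{S_t}^{\dagger}\nabla f(x_t)$ with step sizes $\{\mu_t\}$ (independent of $\{S_t\}$) satisfy the exact error formula $$\mathbb{E}\{\delta_t\}=\prod_{j=0}^{t-1}\Big[\Big(\frac{\theta_1}{\sqrt{\theta_2}}-\mu_j\sqrt{\theta_2}\Big)^2+1-\frac{\theta_1^2}{\theta_2}\Big]\ \mathbb{E}\{\delta_0\}.$$ Consequently, the minimal error is obtained with the constant step size $\mu_t\equiv\mu=\theta_1/\theta_2$, and then $$\frac{\mathbb{E}\{\delta_t\}}{\mathbb{E}\{\delta_0\}}=\Big(1-\frac{\theta_1^2}{\theta_2}\Big)^t .$$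
   Context: Let $n\ge d$, let $A\in\mathbb{R}^{n\times d}$ have full column rank, $b\in\mathbb{R}^d$, $H=A^\top A$, $f(x)=\frac12\langle x,Hx\rangle-\langle b,x\rangle$, $x^*=\mathrm{argmin}_x f(x)$, and $\delta_t=\frac12\langle x_t-x^*,H(x_t-x^* )\rangle$, where $x_0$ is the initial point. For $S\in\mathbb{R}^{m\times n}$ set $H_S=A^\top S^\top SA$; $\dagger$ denotes the pseudo-inverse. The matrices $S_tA$ are assumed to have full column rank almost surely. Inverse unbiased moments condition: a random embedding $S\in\mathbb{R}^{m\times n}$ satisfies the first and second inverse unbiased moments condition if there exists $m_0\ge1$ such that for any $m\ge m_0$ there exist finite real numbers $\theta_1,\theta_2>0$ such that $\mathbb{E}\{C_S^{-1}\}=\theta_1 I_d$ and $\mathbb{E}\{C_S^{-2}\}=\theta_2I_d$ for any matrix $U\in\mathbb{R}^{n\times d}$ with orthonormal columns, where $C_S=U^\top S^\top SU$. In the claim, $m\ge m_0$ and $\theta_1,\theta_2$ are the constants for this $m$. *)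

theory Defs
  imports "HOL-Probability.Probability"
begin

text \<open>
  Dimensions: \<open>d\<close> and \<open>n\<close> are the index types \<open>'d\<close> and \<open>'n\<close>, so that \<open>A :: real^'d^'n\<close> is an
  \<open>n\<close> by \<open>d\<close> matrix. The sketch size \<open>m\<close> is quantified over in the inverse moments condition,
  so it has to be a natural number: an \<open>m\<close> by \<open>n\<close> matrix \<open>S\<close> is the family of its rows
  \<open>S 0, \<dots>, S (m - 1) :: real^'n\<close>, and values \<open>S i\<close> with \<open>i \<ge> m\<close> play no role.
\<close>

type_synonym 'n sketch = "nat \<Rightarrow> real^'n"

definition sketch_space :: "nat \<Rightarrow> 'n::finite sketch measure" where
  "sketch_space m = PiM {..<m} (\<lambda>_. borel)"

text \<open>The \<open>n\<close> by \<open>n\<close> matrix \<open>S\<^sup>T S\<close>.\<close>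

definition sketch_gram :: "nat \<Rightarrow> 'n::finite sketch \<Rightarrow> real^'n^'n" where
  "sketch_gram m S = (\<chi> j k. \<Sum>i<m. S i $ j * S i $ k)"

text \<open>
  \<open>B\<^sup>T S\<^sup>T S B\<close>; this is \<open>H\<^sub>S\<close> for \<open>B = A\<close> and \<open>C\<^sub>S\<close> for \<open>B = U\<close>.
\<close>

definition sketched_gram :: "nat \<Rightarrow> real^'d^'n \<Rightarrow> 'n::finite sketch \<Rightarrow> real^'d^'d" where
  "sketched_gram m B S = transpose B ** sketch_gram m S ** B"

text \<open>
  Rank of the \<open>m\<close> by \<open>d\<close> matrix \<open>S B\<close>, whose \<open>i\<close>-th row is \<open>S i v* B\<close>, as the dimension of the
  row space (as in \<open>row_rank_def\<close>).
\<close>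

definition sketch_rank :: "nat \<Rightarrow> real^'d^'n \<Rightarrow> 'n::finite sketch \<Rightarrow> nat" where
  "sketch_rank m B S = dim ((\<lambda>i. S i v* B) ` {..<m})"

definition orthonormal_columns :: "real^'d^'n \<Rightarrow> bool" where
  "orthonormal_columns U \<longleftrightarrow>
     (\<forall>i j. column i U \<bullet> column j U = (if i = j then 1 else 0))"

definition is_pseudo_inverse :: "real^'n^'m \<Rightarrow> real^'m^'n \<Rightarrow> bool" where
  "is_pseudo_inverse B X \<longleftrightarrow>
     B ** X ** B = B \<and> X ** B ** X = X \<and>
     transpose (B ** X) = B ** X \<and> transpose (X ** B) = X ** B"

definition pseudo_inverse :: "real^'n^'m \<Rightarrow> real^'m^'n" where
  "pseudo_inverse B = (THE X. is_pseudo_inverse B X)"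

text \<open>
  The inverse moments condition concerns the law of \<open>S\<close> only, so a random embedding is
  represented by a probability measure \<open>D\<close> on the space of \<open>m\<close> by \<open>n\<close> matrices.
\<close>

definition embedding_law :: "nat \<Rightarrow> 'n::finite sketch measure \<Rightarrow> bool" where
  "embedding_law m D \<longleftrightarrow> prob_space D \<and> sets D = sets (sketch_space m)"

text \<open>
  \<open>E{C\<^sub>S\<^sup>-\<^sup>1} = \<theta>\<^sub>1 I\<^sub>d\<close> and \<open>E{C\<^sub>S\<^sup>-\<^sup>2} = \<theta>\<^sub>2 I\<^sub>d\<close> for all \<open>U\<close> with orthonormal columns. As \<open>matrix_inv\<close> is
  unspecified at singular matrices and the Bochner integral is \<open>0\<close> for non-integrable
  functions, the almost sure invertibility of \<open>C\<^sub>S\<close> and the existence of both expectations are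
  made explicit. The argument of type \<open>'d itself\<close> gives the number of columns of \<open>U\<close>.
\<close>

definition inverse_moments ::
  "'d::finite itself \<Rightarrow> nat \<Rightarrow> 'n::finite sketch measure \<Rightarrow> real \<Rightarrow> real \<Rightarrow> bool" where
  "inverse_moments _ m D \<theta>1 \<theta>2 \<longleftrightarrow> \<theta>1 > 0 \<and> \<theta>2 > 0 \<and>
     (\<forall>U :: real^'d^'n. orthonormal_columns U \<longrightarrow>
        (AE S in D. invertible (sketched_gram m U S)) \<and>
        integrable D (\<lambda>S. matrix_inv (sketched_gram m U S)) \<and>
        (\<integral>S. matrix_inv (sketched_gram m U S) \<partial>D) = \<theta>1 *\<^sub>R mat 1 \<and>
        integrable D (\<lambda>S. matrix_inv (sketched_gram m U S) ** matrix_inv (sketched_gram m U S)) \<and>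
        (\<integral>S. matrix_inv (sketched_gram m U S) ** matrix_inv (sketched_gram m U S) \<partial>D)
          = \<theta>2 *\<^sub>R mat 1)"

text \<open>
  The first and second inverse unbiased moments condition, with the threshold \<open>m0\<close> displayed,
  for an embedding given by its laws \<open>\<D> m\<close> for every sketch size \<open>m\<close>.
\<close>

definition inverse_unbiased_moments ::
  "'d::finite itself \<Rightarrow> nat \<Rightarrow> (nat \<Rightarrow> 'n::finite sketch measure) \<Rightarrow> bool" where
  "inverse_unbiased_moments d m0 \<D> \<longleftrightarrow>
     m0 \<ge> 1 \<and> (\<forall>m\<ge>m0. \<exists>\<theta>1 \<theta>2. inverse_moments d m (\<D> m) \<theta>1 \<theta>2)"

definition objective :: "real^'d^'n \<Rightarrow> real^'d \<Rightarrow> real^'d \<Rightarrow> real" where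
  "objective A b x = 1/2 * (x \<bullet> ((transpose A ** A) *v x)) - b \<bullet> x"

definition gradient :: "('a::real_inner \<Rightarrow> real) \<Rightarrow> 'a \<Rightarrow> 'a" where
  "gradient f x = (THE D. GDERIV f x :> D)"

definition minimizer :: "real^'d^'n \<Rightarrow> real^'d \<Rightarrow> real^'d" where
  "minimizer A b = arg_min (objective A b) (\<lambda>_. True)"

definition energy_error :: "real^'d^'n \<Rightarrow> real^'d \<Rightarrow> real^'d \<Rightarrow> real" where
  "energy_error A b x =
     1/2 * ((x - minimizer A b) \<bullet> ((transpose A ** A) *v (x - minimizer A b)))"

primrec ihs :: "nat \<Rightarrow> real^'d^'n \<Rightarrow> real^'d \<Rightarrow> (nat \<Rightarrow> real) \<Rightarrow> real^'d \<Rightarrow>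
                (nat \<Rightarrow> 'n::finite sketch) \<Rightarrow> nat \<Rightarrow> real^'d" where
  "ihs m A b \<mu> x0 S 0 = x0"
| "ihs m A b \<mu> x0 S (Suc t) =
     ihs m A b \<mu> x0 S t - \<mu> t *\<^sub>R (pseudo_inverse (sketched_gram m A (S t)) *v
       gradient (objective A b) (ihs m A b \<mu> x0 S t))"

text \<open>The random variable \<open>\<delta>\<^sub>t\<close>.\<close>

definition ihs_error :: "nat \<Rightarrow> real^'d^'n \<Rightarrow> real^'d \<Rightarrow> (nat \<Rightarrow> real) \<Rightarrow> ('w \<Rightarrow> real^'d) \<Rightarrow>
    (nat \<Rightarrow> 'w \<Rightarrow> 'n::finite sketch) \<Rightarrow> nat \<Rightarrow> 'w \<Rightarrow> real" where
  "ihs_error m A b \<mu> x0 S t \<omega> = energy_error A b (ihs m A b \<mu> (x0 \<omega>) (\<lambda>s. S s \<omega>) t)"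

text \<open>
  Independence of two random variables with values in different types; the library's
  \<open>indep_var\<close> requires equal types (cf. \<open>indep_var_eq\<close>).
\<close>

definition independent_rvs ::
  "'w measure \<Rightarrow> 'a measure \<Rightarrow> ('w \<Rightarrow> 'a) \<Rightarrow> 'b measure \<Rightarrow> ('w \<Rightarrow> 'b) \<Rightarrow> bool" where
  "independent_rvs M K X L Y \<longleftrightarrow> X \<in> measurable M K \<and> Y \<in> measurable M L \<and>
     prob_space.indep_set M (sets (vimage_algebra (space M) X K)) (sets (vimage_algebra (space M) Y L))"

end

theory Submission
  imports Defs
begin

text \<open>
  Factor \<open>A = U R\<close> with orthonormal columns in \<open>U\<close> and \<open>R\<close> invertible, and put
  \<open>y\<^sub>t = R (x\<^sub>t - x\<^sup>*)\<close>. Then \<open>\<delta>\<^sub>t = |y\<^sub>t|\<^sup>2 / 2\<close>, and as \<open>H\<^sub>S = R\<^sup>T C\<^sub>S R\<close> the iteration almost surely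
  becomes \<open>y\<^sub>t - \<mu>\<^sub>t G y\<^sub>t\<close> with \<open>G = C\<^sub>S\<^sup>-\<^sup>1\<close>. The entries of \<open>y\<^sub>t y\<^sub>t\<^sup>T\<close> depend on \<open>x\<^sub>0\<close> and the past
  sketches, hence are independent of those of \<open>G\<close> and \<open>G\<^sup>2\<close>, and the moment condition turns the
  expectation of \<open>|y - \<mu> G y|\<^sup>2 = |y|\<^sup>2 - 2 \<mu> y\<^sup>T G y + \<mu>\<^sup>2 y\<^sup>T G\<^sup>2 y\<close> into
  \<open>(1 - 2 \<mu> \<theta>\<^sub>1 + \<mu>\<^sup>2 \<theta>\<^sub>2) E|y|\<^sup>2\<close>.
\<close>

section \<open>The pseudo-inverse\<close>

text \<open>
  The probability space need not be complete, so the iterates must be shown to be measurable also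
  where \<open>H\<^sub>S\<close> is singular. The preimage of a compact set under a function with closed graph is
  closed. Where no \<open>y\<close> with \<open>P x y\<close> exists, the description operator returns one fixed value, so
  existence is not needed.
\<close>

lemma borel_measurable_The_closed_graph:
  fixes P :: "'a::euclidean_space \<Rightarrow> 'b::euclidean_space \<Rightarrow> bool"
  assumes closed: "closed {(y, x). P x y}"
    and unique: "\<And>x y z. P x y \<Longrightarrow> P x z \<Longrightarrow> y = z"
  shows "(\<lambda>x. THE y. P x y) \<in> borel_measurable borel"
proof -
  have The: "(THE y. P x y) = y" if "P x y" for x y
    using that unique by blast
  have junk: "(THE y. P x y) = (THE y. False)" if "\<nexists>y. P x y" for x
    using that by presburger
  \<comment> \<open>Projections along a compact set preserve closedness. An open set is a countable
    union of compact sets, so its projection is a countable union of closed sets.\<close>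
  have proj: "{x. \<exists>y\<in>V. P x y} \<in> sets borel" if "open V" for V
  proof -
    obtain C where C: "\<And>n :: nat. compact (C n)" "\<Union>(range C) = V"
      using open_Union_compact_subsets[OF \<open>open V\<close>] by metis
    have "closed {x. \<exists>y. y \<in> C n \<and> (y, x) \<in> {(y, x). P x y}}" for n :: nat
      using C(1) closed by (rule closed_compact_projection)
    then have "(\<Union>n. {x. \<exists>y. y \<in> C n \<and> P x y}) \<in> sets borel"
      by (intro sets.countable_UN) auto
    also have "(\<Union>n. {x. \<exists>y. y \<in> C n \<and> P x y}) = {x. \<exists>y\<in>V. P x y}"
      using C(2) by blast
    finally show ?thesis .
  qed
  show ?thesis
  proof (rule borel_measurableI)
    fix V :: "'b set" assume "open V"
    \<comment> \<open>\<open>THE y. False\<close> is the default value: if it lies in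
      \<open>V\<close>, the preimage also contains all \<open>x\<close> without a partner, and these
      form the complement of the projection taken with \<open>V = UNIV\<close>.\<close>
    have "(\<lambda>x. THE y. P x y) -` V =
      {x. \<exists>y\<in>V. P x y} \<union> (if (THE y. False) \<in> V then - {x. \<exists>y\<in>UNIV. P x y} else {})"
      using The junk by (auto split: if_splits) (metis The junk)+
    moreover have "\<dots> \<in> sets borel"
      using proj[OF \<open>open V\<close>] proj[OF open_UNIV] by (auto simp: Compl_eq_Diff_UNIV)
    ultimately show "(\<lambda>x. THE y. P x y) -` V \<inter> space borel \<in> sets borel"
      by simp
  qed
qed

text \<open>The symmetric products \<open>B ** X\<close> and \<open>B ** Y\<close> are both the
  orthogonal projection onto the column space of \<open>B\<close>, so they agree; likewise
  \<open>X ** B = Y ** B\<close>. Then X = XBX = YBX = YBY = Y.\<close>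

lemma is_pseudo_inverse_unique:
  assumes "is_pseudo_inverse B X" "is_pseudo_inverse B Y"
  shows "X = Y"
proof -
  have X: "B ** X ** B = B" "X ** B ** X = X" "transpose (B ** X) = B ** X" "transpose (X ** B) = X ** B"
    and Y: "B ** Y ** B = B" "Y ** B ** Y = Y" "transpose (B ** Y) = B ** Y" "transpose (Y ** B) = Y ** B"
    using assms by (auto simp: is_pseudo_inverse_def)
  have "B ** X = transpose ((B ** Y) ** (B ** X))"
    using X(3) Y(1) by (simp add: matrix_mul_assoc)
  also have "\<dots> = (B ** X) ** (B ** Y)"
    unfolding matrix_transpose_mul[of "B ** Y"] X(3) Y(3) ..
  finally have BX: "B ** X = B ** Y"
    using X(1) by (simp add: matrix_mul_assoc)
  have "X ** B = transpose ((X ** B) ** (Y ** B))"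
    by (metis X(4) Y(1) matrix_mul_assoc)
  also have "\<dots> = (Y ** B) ** (X ** B)"
    unfolding matrix_transpose_mul[of "X ** B"] X(4) Y(4) ..
  finally have XB: "X ** B = Y ** B"
    by (metis X(1) matrix_mul_assoc)
  show ?thesis
    by (metis BX XB X(2) Y(2) matrix_mul_assoc)
qed

lemma continuous_on_matrix_mult [continuous_intros]:
  fixes F :: "'a::topological_space \<Rightarrow> real^'n^'m" and G :: "'a \<Rightarrow> real^'k^'n"
  shows "continuous_on T F \<Longrightarrow> continuous_on T G \<Longrightarrow> continuous_on T (\<lambda>x. F x ** G x)"
  unfolding matrix_matrix_mult_def by (intro continuous_intros)

lemma continuous_on_transpose [continuous_intros]:
  fixes F :: "'a::topological_space \<Rightarrow> real^'n^'m"
  shows "continuous_on T F \<Longrightarrow> continuous_on T (\<lambda>x. transpose (F x))"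
  unfolding transpose_def by (intro continuous_intros)

text \<open>The pseudo-inverse is discontinuous where the rank drops. Its graph is nevertheless
  closed, as the four defining equations are continuous jointly in \<open>X\<close> and
  \<open>B\<close>.\<close>

lemma pseudo_inverse_measurable:
  "(pseudo_inverse :: real^'n^'m \<Rightarrow> real^'m^'n) \<in> borel_measurable borel"
proof -
  have "closed {(X, B :: real^'n^'m). is_pseudo_inverse B X}"
    unfolding is_pseudo_inverse_def case_prod_unfold
    by (intro closed_Collect_conj closed_Collect_eq continuous_intros)
  from borel_measurable_The_closed_graph[OF this is_pseudo_inverse_unique]
  show ?thesis
    unfolding pseudo_inverse_def[abs_def] .
qed

lemma
  fixes B :: "'a::semiring_1^'n^'m"
  assumes "invertible B"
  shows mult_matrix_inv_right: "B ** matrix_inv B = mat 1"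
    and mult_matrix_inv_left: "matrix_inv B ** B = mat 1"
  using someI_ex[OF assms[unfolded invertible_def]] unfolding matrix_inv_def by auto

lemma matrix_inv_unique_left:
  fixes B :: "'a::semiring_1^'n^'m"
  assumes "invertible B" "X ** B = mat 1"
  shows "matrix_inv B = X"
  by (metis assms mult_matrix_inv_right matrix_mul_assoc matrix_mul_lid matrix_mul_rid)

lemma pseudo_inverse_eq_matrix_inv:
  assumes "invertible B"
  shows "pseudo_inverse B = matrix_inv B"
proof -
  have "is_pseudo_inverse B (matrix_inv B)"
    by (simp add: is_pseudo_inverse_def mult_matrix_inv_right[OF assms] mult_matrix_inv_left[OF assms])
  then show ?thesis
    unfolding pseudo_inverse_def by (blast intro: is_pseudo_inverse_unique)
qed

section \<open>Reduction to orthonormal columns\<close>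

text \<open>The columns of \<open>U\<close> are an orthonormal basis of the column space of
  \<open>A\<close>; full rank provides exactly one basis vector per index in \<open>'d\<close>. The
  coordinates of the columns of \<open>A\<close> in this basis form \<open>R\<close>, which inherits
  injectivity from \<open>A\<close>.\<close>

lemma full_column_rank_factorization:
  fixes A :: "real^'d^'n"
  assumes "rank A = CARD('d)"
  obtains U :: "real^'d^'n" and R :: "real^'d^'d"
  where "orthonormal_columns U" "invertible R" "A = U ** R"
proof -
  have inj: "inj ((*v) A)"
    using assms by (simp add: full_rank_injective)
  have "subspace (range ((*v) A))"
    by (simp add: linear_subspace_image)
  then obtain B where B: "pairwise orthogonal B" "\<And>x. x \<in> B \<Longrightarrow> norm x = 1" "independent B"
    "card B = dim (range ((*v) A))" "span B = range ((*v) A)"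
    by (rule orthonormal_basis_subspace) auto
  have "finite B" "card B = CARD('d)"
    using B(3,4) assms by (auto simp: rank_dim_range independent_imp_finite)
  then obtain f :: "'d \<Rightarrow> real^'n" where f: "bij_betw f UNIV B"
    by (metis finite_same_card_bij finite)
  define U where "U = (\<chi> i j. f j $ i)"
  have col: "column j U = f j" for j
    by (simp add: U_def column_def)
  have "f i \<bullet> f j = (if i = j then 1 else 0)" for i j
  proof (cases "i = j")
    case True
    then show ?thesis
      using B(2)[of "f j"] f by (auto simp: bij_betw_def norm_eq_1)
  next
    case False
    then have "f i \<noteq> f j" "f i \<in> B" "f j \<in> B"
      using f by (auto simp: bij_betw_def inj_def)
    then show ?thesis
      using B(1) False by (auto simp: pairwise_def orthogonal_def)
  qed
  then have U: "orthonormal_columns U"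
    by (simp add: orthonormal_columns_def col)
  have "columns U = B"
    using f by (auto simp: columns_def col bij_betw_def)
  moreover have "span (columns U) \<subseteq> range ((*v) U)"
    by (intro span_minimal) (auto simp: linear_subspace_image columns_image_basis)
  ultimately have "\<exists>r. A *v axis j 1 = U *v r" for j
    using B(5) by auto
  then obtain r where r: "\<And>j. A *v axis j 1 = U *v r j"
    by metis
  define R where "R = (\<chi> i j. r j $ i)"
  have "(U ** R) *v axis j 1 = A *v axis j 1" for j
  proof -
    have "R *v axis j 1 = r j"
      by (simp add: R_def matrix_vector_mult_basis column_def)
    then show ?thesis
      by (simp add: r flip: matrix_vector_mul_assoc)
  qed
  then have A: "A = U ** R"
    by (simp add: matrix_vector_mult_basis column_def vec_eq_iff)
  have "inj ((*v) R)"
    using inj unfolding A by (auto simp: inj_def simp flip: matrix_vector_mul_assoc)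
  then have "invertible R"
    by (simp add: invertible_left_inverse matrix_left_invertible_injective)
  with U A that show ?thesis by blast
qed

lemma orthonormal_columns_transpose_mult:
  "orthonormal_columns U \<Longrightarrow> transpose U ** U = mat 1"
  by (simp add: matrix_mult_transpose_dot_column orthonormal_columns_def mat_def vec_eq_iff)

lemma sketched_gram_mult:
  "sketched_gram m (U ** R) S = transpose R ** sketched_gram m U S ** R"
  by (simp add: sketched_gram_def matrix_transpose_mul matrix_mul_assoc)

lemma transpose_sketched_gram: "transpose (sketched_gram m B S) = sketched_gram m B S"
proof -
  have "transpose (sketch_gram m S) = sketch_gram m S"
    by (simp add: sketch_gram_def transpose_def mult.commute)
  then show ?thesis
    by (simp add: sketched_gram_def matrix_transpose_mul matrix_mul_assoc)
qed

lemma transpose_matrix_inv: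
  fixes B :: "real^'n^'n"
  assumes "invertible B"
  shows "transpose (matrix_inv B) = matrix_inv (transpose B)"
  by (metis assms transpose_invertible matrix_inv_unique_left matrix_transpose_mul
      mult_matrix_inv_right transpose_mat)

section \<open>Gradient, minimizer and energy of the quadratic objective\<close>

lemma inner_transpose_mult:
  fixes B :: "real^'n^'m"
  shows "x \<bullet> (transpose B *v y) = (B *v x) \<bullet> y"
  using dot_lmul_matrix[of x "transpose B" y] by simp

lemma GDERIV_quadratic:
  fixes B :: "real^'n^'n"
  assumes "transpose B = B"
  shows "GDERIV (\<lambda>x. 1/2 * (x \<bullet> (B *v x)) - b \<bullet> x) x :> B *v x - b"
proof -
  \<comment> \<open>Symmetry of \<open>B\<close> makes the two terms of the product rule equal,
    which absorbs the factor 1/2.\<close>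
  have sym: "x \<bullet> (B *v h) = h \<bullet> (B *v x)" for h
    using inner_transpose_mult[of x B h] by (simp only: assms inner_commute)
  have "((\<lambda>x. x \<bullet> (B *v x)) has_derivative (\<lambda>h. x \<bullet> (B *v h) + h \<bullet> (B *v x))) (at x)"
    by (intro has_derivative_inner has_derivative_ident bounded_linear_imp_has_derivative
        matrix_vector_mul_bounded_linear)
  then have "((\<lambda>x. 1/2 * (x \<bullet> (B *v x)) - b \<bullet> x) has_derivative
      (\<lambda>h. 1/2 * (x \<bullet> (B *v h) + h \<bullet> (B *v x)) - b \<bullet> h)) (at x)"
    by (intro has_derivative_diff has_derivative_mult_right has_derivative_inner_right has_derivative_ident)
  then show ?thesis
    by (simp add: gderiv_def sym inner_diff_right inner_commute)
qed

lemma gradient_eqI: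
  assumes "GDERIV f x :> D"
  shows "gradient f x = D"
  unfolding gradient_def
proof (rule the_equality)
  fix D' assume "GDERIV f x :> D'"
  then have "(\<lambda>h. h \<bullet> D') = (\<lambda>h. h \<bullet> D)"
    using assms unfolding gderiv_def by (rule has_derivative_unique)
  then show "D' = D"
    by (simp add: fun_eq_iff vector_eq_ldot)
qed fact

lemma gradient_objective:
  "gradient (objective A b) x = (transpose A ** A) *v x - b"
  unfolding objective_def[abs_def]
  by (intro gradient_eqI GDERIV_quadratic) (simp add: matrix_transpose_mul)

lemma gram_factorization:
  assumes "orthonormal_columns U"
  shows "transpose (U ** R) ** (U ** R) = transpose R ** R"
proof -
  have "transpose (U ** R) ** (U ** R) = transpose R ** (transpose U ** U) ** R"
    by (simp only: matrix_transpose_mul matrix_mul_assoc)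
  then show ?thesis
    by (simp add: orthonormal_columns_transpose_mult[OF assms])
qed

lemma inner_gram:
  fixes R :: "real^'n^'m"
  shows "x \<bullet> ((transpose R ** R) *v y) = (R *v x) \<bullet> (R *v y)"
  by (simp only: inner_transpose_mult flip: matrix_vector_mul_assoc)

text \<open>As \<open>arg_min\<close> is a choice, existence has to come first. With
  \<open>z\<close> solving the normal equation, completing the square gives f(x) = f(z) + |R(x -
  z)|^2 / 2. So \<open>z\<close> is a minimizer, and every minimizer equals \<open>z\<close> because
  \<open>R\<close> is invertible.\<close>

lemma minimizer_normal_equation:
  fixes U :: "real^'d^'n" and R :: "real^'d^'d"
  assumes U: "orthonormal_columns U" and R: "invertible R"
  shows "(transpose R ** R) *v minimizer (U ** R) b = b"
proof -
  let ?H = "transpose R ** R"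
  let ?f = "objective (U ** R) b"
  have inv: "invertible ?H"
    by (rule invertible_mult[OF transpose_invertible[OF R] R])
  define z where "z = matrix_inv ?H *v b"
  have Hz: "?H *v z = b"
    by (simp add: z_def matrix_vector_mul_assoc mult_matrix_inv_right[OF inv])
  have excess: "?f x = ?f z + 1/2 * (norm (R *v (x - z)))\<^sup>2" for x
  proof -
    \<comment> \<open>The normal equation for \<open>z\<close> writes the linear term through
      \<open>R\<close> too, so the objective involves only inner products of \<open>R *v x\<close>
      and \<open>R *v z\<close>.\<close>
    have "b \<bullet> x = (R *v x) \<bullet> (R *v z)" for x
      using inner_gram[of x R z] by (simp only: Hz inner_commute)
    then have f: "?f x = 1/2 * ((R *v x) \<bullet> (R *v x)) - (R *v x) \<bullet> (R *v z)" for x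
      by (simp only: objective_def gram_factorization[OF U] inner_gram)
    show ?thesis
      unfolding f power2_norm_eq_inner matrix_vector_mult_diff_distrib inner_diff
        inner_commute[of "R *v z" "R *v x"]
      by (simp add: algebra_simps)
  qed
  have "?f z \<le> ?f x" for x
    using excess[of x] by simp
  then have "is_arg_min ?f (\<lambda>_. True) z"
    by (simp add: is_arg_min_def not_less)
  then have "is_arg_min ?f (\<lambda>_. True) (minimizer (U ** R) b)"
    unfolding minimizer_def arg_min_def by (rule someI)
  then have "?f (minimizer (U ** R) b) \<le> ?f z"
    by (auto simp: is_arg_min_def not_less)
  then have "R *v (minimizer (U ** R) b - z) = 0"
    using excess[of "minimizer (U ** R) b"] by simp
  from arg_cong[OF this, of "(*v) (matrix_inv R)"] have "minimizer (U ** R) b = z"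
    by (simp add: matrix_vector_mul_assoc mult_matrix_inv_left[OF R])
  with Hz show ?thesis by simp
qed

lemma energy_error_eq_norm:
  assumes "orthonormal_columns U"
  shows "energy_error (U ** R) b x = 1/2 * (norm (R *v (x - minimizer (U ** R) b)))\<^sup>2"
  by (simp add: energy_error_def gram_factorization[OF assms] inner_gram power2_norm_eq_inner)

text \<open>The identity holds for each fixed sketch with invertible C_S, before any expectation.
  With R^-T the inverse of the transpose of \<open>R\<close>, the pseudo-inverse of H_S is R^-1 G
  R^-T and the gradient is R^T y, so in the coordinates y the update direction is G y. Expanding |y
  - \<mu> G y|^2 / 2 gives the three terms.\<close>

lemma energy_error_step:
  fixes U :: "real^'d^'n" and R :: "real^'d^'d" and b :: "real^'d"
  assumes U: "orthonormal_columns U" and R: "invertible R"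
    and C: "invertible (sketched_gram m U S)"
  defines "y x \<equiv> R *v (x - minimizer (U ** R) b)"
    and "G \<equiv> matrix_inv (sketched_gram m U S)"
  shows "energy_error (U ** R) b
      (x - \<mu> *\<^sub>R (pseudo_inverse (sketched_gram m (U ** R) S) *v gradient (objective (U ** R) b) x)) =
    energy_error (U ** R) b x - \<mu> * (y x \<bullet> (G *v y x)) + \<mu>\<^sup>2 / 2 * (y x \<bullet> ((G ** G) *v y x))"
proof -
  let ?C = "sketched_gram m U S" and ?R' = "matrix_inv R"
  have RR: "transpose ?R' ** transpose R = mat 1"
    using arg_cong[OF mult_matrix_inv_right[OF R], of transpose] by (simp add: matrix_transpose_mul)
  have "(?R' ** G ** transpose ?R') ** (transpose R ** ?C ** R)
      = ?R' ** (G ** ((transpose ?R' ** transpose R) ** ?C)) ** R"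
    by (simp only: matrix_mul_assoc)
  also have "\<dots> = mat 1"
    by (simp add: RR G_def mult_matrix_inv_left[OF C] mult_matrix_inv_left[OF R])
  finally have "pseudo_inverse (sketched_gram m (U ** R) S) = ?R' ** G ** transpose ?R'"
    using C R by (simp add: sketched_gram_mult pseudo_inverse_eq_matrix_inv matrix_inv_unique_left
        invertible_mult transpose_invertible)
  moreover have "gradient (objective (U ** R) b) x = transpose R *v y x"
    using minimizer_normal_equation[OF U R, of b]
    by (simp add: gradient_objective gram_factorization[OF U] y_def matrix_vector_mul_assoc
        matrix_vector_mult_diff_distrib del: transpose_matrix_vector)
  ultimately have "R *v (pseudo_inverse (sketched_gram m (U ** R) S) *v gradient (objective (U ** R) b) x)
      = (R ** ?R') *v (G *v ((transpose ?R' ** transpose R) *v y x))"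
    by (simp add: matrix_vector_mul_assoc matrix_mul_assoc del: transpose_matrix_vector)
  also have "\<dots> = G *v y x"
    by (simp add: RR mult_matrix_inv_right[OF R])
  finally have RG: "R *v (pseudo_inverse (sketched_gram m (U ** R) S) *v gradient (objective (U ** R) b) x) = G *v y x" .
  have step: "y (x - \<mu> *\<^sub>R v) = y x - \<mu> *\<^sub>R (R *v v)" for v
    unfolding y_def matrix_vector_mult_diff_distrib matrix_vector_mult_scaleR by (simp add: algebra_simps)
  \<comment> \<open>\<open>G\<close> is symmetric as the inverse of a symmetric matrix, which turns
    |G y|^2 into the quadratic form of \<open>G ** G\<close>.\<close>
  have "transpose G = matrix_inv (transpose (sketched_gram m U S))"
    unfolding G_def by (rule transpose_matrix_inv[OF C])
  then have "transpose G = G"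
    unfolding transpose_sketched_gram G_def .
  then have GG: "(G *v y x) \<bullet> (G *v y x) = y x \<bullet> ((G ** G) *v y x)"
    using inner_gram[of "y x" G "y x"] by (simp only:)
  have energy: "energy_error (U ** R) b z = 1/2 * (y z \<bullet> y z)" for z
    unfolding energy_error_eq_norm[OF U] y_def power2_norm_eq_inner ..
  show ?thesis
    unfolding energy step RG
    unfolding inner_diff inner_scaleR_left inner_scaleR_right GG inner_commute[of "G *v y x" "y x"]
    by (simp add: power2_eq_square algebra_simps)
qed

section \<open>Measurability and independence\<close>

lemma borel_measurable_vec_lambda:
  fixes f :: "'n::finite \<Rightarrow> 'a \<Rightarrow> 'b::euclidean_space"
  assumes "\<And>i. f i \<in> borel_measurable M"
  shows "(\<lambda>x. \<chi> i. f i x) \<in> borel_measurable M"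
proof (subst borel_measurable_euclidean_space, intro ballI)
  fix e :: "'b^'n" assume "e \<in> Basis"
  then obtain i u where "e = axis i u"
    by (auto simp: Basis_vec_def)
  then show "(\<lambda>x. (\<chi> i. f i x) \<bullet> e) \<in> borel_measurable M"
    using assms by (simp add: inner_axis)
qed

lemma borel_measurable_vec_nth:
  "(\<lambda>x. x $ i) \<in> borel_measurable (borel :: ('b::euclidean_space^'n::finite) measure)"
  by (intro borel_measurable_continuous_onI continuous_intros)

lemma measurable_sketched_gram:
  fixes B :: "real^'d^'n"
  shows "sketched_gram m B \<in> borel_measurable (sketch_space m)"
proof -
  have "(\<lambda>S. S i $ j) \<in> borel_measurable (sketch_space m)" if "i < m" for i and j :: 'n
  proof -
    have "(\<lambda>S. S i) \<in> borel_measurable (sketch_space m :: 'n sketch measure)"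
      unfolding sketch_space_def using that by (intro measurable_component_singleton) auto
    then show ?thesis
      by (rule measurable_compose[OF _ borel_measurable_vec_nth])
  qed
  then have "sketch_gram m \<in> borel_measurable (sketch_space m :: 'n sketch measure)"
    unfolding sketch_gram_def[abs_def]
    by (intro borel_measurable_vec_lambda borel_measurable_sum borel_measurable_times) auto
  then show ?thesis
    unfolding sketched_gram_def[abs_def]
    by (rule measurable_compose) (intro borel_measurable_continuous_onI continuous_intros)
qed

lemma borel_measurable_matrix_vector_mult:
  fixes F :: "'a \<Rightarrow> real^'n^'m"
  assumes "F \<in> borel_measurable M" "f \<in> borel_measurable M"
  shows "(\<lambda>x. F x *v f x) \<in> borel_measurable M"
proof -
  have "continuous_on UNIV (\<lambda>p :: (real^'n^'m) \<times> (real^'n). fst p *v snd p)"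
    unfolding matrix_vector_mult_def by (intro continuous_intros)
  from borel_measurable_continuous_Pair[OF assms this] show ?thesis by simp
qed

text \<open>The sigma-algebra of \<open>K\<close> is kept general. Taking for \<open>K\<close> the
  one generated by \<open>x0\<close> and the sketches before \<open>t\<close> shows that the iterate
  depends on the past only; taking the whole probability space gives ordinary measurability.\<close>

lemma ihs_measurable:
  assumes "x0 \<in> borel_measurable K"
    and "\<And>s. s < t \<Longrightarrow> S s \<in> measurable K (sketch_space m)"
  shows "(\<lambda>\<omega>. ihs m A b \<mu> (x0 \<omega>) (\<lambda>s. S s \<omega>) t) \<in> borel_measurable K"
  using assms(2)
proof (induction t)
  case 0
  then show ?case using assms(1) by simp
next
  case (Suc t)
  then have x: "(\<lambda>\<omega>. ihs m A b \<mu> (x0 \<omega>) (\<lambda>s. S s \<omega>) t) \<in> borel_measurable K"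
    by simp
  have "(\<lambda>\<omega>. pseudo_inverse (sketched_gram m A (S t \<omega>))) \<in> borel_measurable K"
    using Suc.prems[of t]
    by (intro measurable_compose[OF _ pseudo_inverse_measurable] measurable_compose[OF _ measurable_sketched_gram]) auto
  moreover have "(\<lambda>\<omega>. gradient (objective A b) (ihs m A b \<mu> (x0 \<omega>) (\<lambda>s. S s \<omega>) t)) \<in> borel_measurable K"
    unfolding gradient_objective using x
    by (intro borel_measurable_diff borel_measurable_matrix_vector_mult) auto
  ultimately show ?case
    unfolding ihs.simps
    by (intro borel_measurable_diff x borel_measurable_scaleR borel_measurable_matrix_vector_mult borel_measurable_const)
qed

text \<open>The natural filtration of the iteration at time \<open>t\<close>, packaged as a measure
  so that \<open>measurable\<close> can express dependence on the past alone. Generating it from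
  events avoids a joint random variable for \<open>X\<close> and the sketches, whose types
  differ.\<close>

definition past ::
  "'w measure \<Rightarrow> 'a measure \<Rightarrow> ('w \<Rightarrow> 'a) \<Rightarrow> 'b measure \<Rightarrow> (nat \<Rightarrow> 'w \<Rightarrow> 'b) \<Rightarrow> nat \<Rightarrow> 'w measure" where
  "past M K X N S t = sigma (space M)
     (sets (vimage_algebra (space M) X K) \<union> (\<Union>s<t. sets (vimage_algebra (space M) (S s) N)))"

lemma sets_vimage_algebra_into_space: "A \<in> sets (vimage_algebra \<Omega> f N) \<Longrightarrow> A \<subseteq> \<Omega>"
  by (metis sets.sets_into_space space_vimage_algebra)

lemma past_generators:
  "sets (vimage_algebra (space M) X K) \<union> (\<Union>s<t. sets (vimage_algebra (space M) (S s) N)) \<subseteq> Pow (space M)"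
  by (auto dest!: sets_vimage_algebra_into_space)

lemma space_past [simp]: "space (past M K X N S t) = space M"
  unfolding past_def by (rule space_measure_of[OF past_generators])

lemma sets_past: "sets (past M K X N S t) = sigma_sets (space M)
    (sets (vimage_algebra (space M) X K) \<union> (\<Union>s<t. sets (vimage_algebra (space M) (S s) N)))"
  unfolding past_def by (rule sets_measure_of[OF past_generators])

lemma measurable_past_initial:
  assumes "X \<in> space M \<rightarrow> space K"
  shows "X \<in> measurable (past M K X N S t) K"
  using assms by (auto intro!: measurableI sigma_sets.Basic in_vimage_algebra simp: sets_past)

lemma measurable_past:
  assumes "s < t" "S s \<in> space M \<rightarrow> space N"
  shows "S s \<in> measurable (past M K X N S t) N"
proof (rule measurableI)
  fix A assume "A \<in> sets N"
  then have "S s -` A \<inter> space M \<in> (\<Union>s<t. sets (vimage_algebra (space M) (S s) N))"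
    using assms(1) by (blast intro: in_vimage_algebra)
  then show "S s -` A \<inter> space (past M K X N S t) \<in> sets (past M K X N S t)"
    by (simp add: sets_past sigma_sets.Basic)
qed (use assms(2) in auto)

text \<open>Independence of \<open>X\<close> from the whole sequence, together with mutual
  independence within the sequence, makes all the sigma-algebras of \<open>X\<close>,
  \<open>S 0\<close>, \<open>S 1\<close>, ... mutually independent. Grouping this family into two
  disjoint blocks of indices gives the claim.\<close>

lemma (in prob_space) indep_past_present:
  assumes S: "indep_vars (\<lambda>_. N) S UNIV"
    and X: "independent_rvs M K X (PiM UNIV (\<lambda>_. N)) (\<lambda>\<omega> t. S t \<omega>)"
  shows "indep_set (sets (past M K X N S t)) (sets (vimage_algebra (space M) (S t) N))"
proof -
  let ?FX = "sets (vimage_algebra (space M) X K)"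
  let ?FS = "\<lambda>s. sets (vimage_algebra (space M) (S s) N)"
  let ?seq = "vimage_algebra (space M) (\<lambda>\<omega> t. S t \<omega>) (PiM UNIV (\<lambda>_. N))"
  \<comment> \<open>Index 0 stands for \<open>X\<close> and index \<open>Suc s\<close> for
    \<open>S s\<close>. Hence the past at time \<open>t\<close> is the block \<open>{..t}\<close>
    and the present sketch is the single index \<open>Suc t\<close>.\<close>
  define F where "F = case_nat ?FX ?FS"
  have rvS: "random_variable N (S s)" for s
    using S by (simp add: indep_vars_def)
  have FS_eq: "?FS s = sigma_sets (space M) {S s -` A \<inter> space M |A. A \<in> sets N}" for s
    by (rule sets_vimage_algebra)
  have indepS: "indep_sets ?FS UNIV"
    unfolding FS_eq using S by (simp add: indep_vars_def)
  have indepX: "indep_set ?FX (sets ?seq)"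
    using X by (simp add: independent_rvs_def)
  have FS_seq: "?FS s \<subseteq> sets ?seq" for s
  proof (rule sets_image_in_sets)
    show "space ?seq = space M" by simp
    have "(\<lambda>\<omega> t. S t \<omega>) \<in> measurable ?seq (PiM UNIV (\<lambda>_. N))"
      using rvS by (intro measurable_vimage_algebra1) (auto simp: space_PiM intro: measurable_space)
    from measurable_compose[OF this measurable_component_singleton[of s]]
    show "S s \<in> measurable ?seq N" by simp
  qed
  have indepF: "indep_sets F UNIV"
  proof (rule indep_setsI)
    show "F i \<subseteq> events" for i
      using indepS indepX by (cases i) (auto simp: F_def indep_sets_def dest: indep_setD_ev1)
  next
    fix A J assume J: "J \<noteq> {}" "finite J" and A: "\<forall>j\<in>J. A j \<in> F j"
    define J' where "J' = {s. Suc s \<in> J}"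
    \<comment> \<open>\<open>B\<close> collects the constraints on the sketches into one event of
      the sequence, to be split off from \<open>A 0\<close>. Intersecting with
      \<open>space M\<close> covers empty \<open>J'\<close>, where the bare intersection would be
      \<open>UNIV\<close>.\<close>
    define B where "B = space M \<inter> (\<Inter>s\<in>J'. A (Suc s))"
    have "J' = Suc -` J" by (auto simp: J'_def)
    then have fin: "finite J'"
      using J(2) by (simp add: finite_vimageI)
    have A': "A (Suc s) \<in> ?FS s" if "s \<in> J'" for s
      using A that by (auto simp: J'_def F_def)
    have A0: "A 0 \<in> ?FX" if "0 \<in> J"
      using A that by (auto simp: F_def)
    have sub: "A j \<subseteq> space M" if "j \<in> J" for j
    proof (cases j)
      case 0
      then show ?thesis
        using that A0 by (simp add: sets_vimage_algebra_into_space)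
    next
      case (Suc s)
      then show ?thesis
        using that A'[of s] by (simp add: J'_def sets_vimage_algebra_into_space)
    qed
    have Bseq: "B \<in> sets ?seq"
    proof -
      have top: "space M \<in> sets ?seq"
        using sets.top[of ?seq] by (simp only: space_vimage_algebra)
      have "A (Suc s) \<in> sets ?seq" if "s \<in> J'" for s
        using A'[OF that] FS_seq by blast
      then show ?thesis
        using top fin sets.finite_INT[of J' "\<lambda>s. A (Suc s)" ?seq]
        by (cases "J' = {}") (simp_all add: B_def sets.Int)
    qed
    have probB: "prob B = (\<Prod>s\<in>J'. prob (A (Suc s)))"
    proof (cases "J' = {}")
      case True
      then show ?thesis by (simp add: B_def prob_space)
    next
      case False
      then have "B = (\<Inter>s\<in>J'. A (Suc s))"
        using sub by (auto simp: B_def J'_def)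
      then show ?thesis
        using indep_setsD[OF indepS, of J' "\<lambda>s. A (Suc s)"] False fin A' by auto
    qed
    have split: "x \<in> Suc ` J' \<longleftrightarrow> x \<in> J - {0}" for x
      by (cases x) (auto simp: J'_def)
    show "prob (\<Inter>j\<in>J. A j) = (\<Prod>j\<in>J. prob (A j))"
    proof (cases "0 \<in> J")
      case True
      then have J_eq: "J = insert 0 (Suc ` J')" using split by blast
      have "(\<Inter>j\<in>J. A j) = A 0 \<inter> B"
        using sub[OF True] by (auto simp: J_eq B_def)
      moreover have "prob (A 0 \<inter> B) = prob (A 0) * prob B"
        using indepX A0[OF True] Bseq by (rule indep_setD)
      ultimately show ?thesis
        by (simp add: J_eq fin probB prod.reindex)
    next
      case False
      then have J_eq: "J = Suc ` J'" using split by blast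
      then have "J' \<noteq> {}" using J(1) by auto
      moreover have "A (Suc s) \<subseteq> space M" if "s \<in> J'" for s
        using sub that by (simp add: J'_def)
      ultimately have "(\<Inter>j\<in>J. A j) = B"
        unfolding J_eq B_def by blast
      then show ?thesis
        by (simp add: J_eq probB prod.reindex)
    qed
  qed
  \<comment> \<open>Disjoint blocks of an independent family of intersection-stable systems generate
    independent sigma-algebras.\<close>
  have "indep_sets (\<lambda>c. sigma_sets (space M) (\<Union>i\<in>case_bool {..t} {Suc t} c. F i)) UNIV"
  proof (rule indep_sets_collect_sigma)
    show "indep_sets F (\<Union>c\<in>UNIV. case_bool {..t} {Suc t} c)"
      using indepF by (rule indep_sets_mono_index[rotated]) simp
    show "Int_stable (F i)" for i
      by (cases i) (auto simp: F_def intro: sets.Int_stable)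
    show "disjoint_family_on (case_bool {..t} {Suc t}) UNIV"
      by (auto simp: disjoint_family_on_def split: bool.splits)
  qed
  moreover have "sigma_sets (space M) (\<Union>i\<in>{Suc t}. F i) = ?FS t"
    using sets.sigma_sets_eq[of "vimage_algebra (space M) (S t) N"] by (simp add: F_def)
  moreover have "(\<Union>i\<in>{..t}. F i) = ?FX \<union> (\<Union>s<t. ?FS s)"
  proof -
    have "{..t} = insert 0 (Suc ` {..<t})"
      by (simp add: lessThan_Suc_atMost[symmetric] lessThan_Suc_eq_insert_0)
    then show ?thesis by (simp add: F_def)
  qed
  ultimately have "indep_sets (case_bool (sets (past M K X N S t)) (?FS t)) UNIV"
    unfolding sets_past
    by (elim indep_sets_mono_sets) (auto split: bool.split simp del: Sup_insert)
  then show ?thesis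
    by (simp add: indep_set_def)
qed

section \<open>Expectation of a quadratic form with an independent random matrix\<close>

lemma (in prob_space) indep_var_of_indep_set:
  assumes indep: "indep_set (sets K) (sets L)"
    and "space K = space M" "space L = space M"
    and f: "f \<in> measurable K S" and g: "g \<in> measurable L T"
  shows "indep_var S f T g"
proof -
  have sub: "sets K \<subseteq> events" "sets L \<subseteq> events"
    using indep_setD_ev1[OF indep] indep_setD_ev2[OF indep] by auto
  have rv: "random_variable S f" "random_variable T g"
    using f g sub assms(2,3) by (auto simp: measurable_def)
  have "sigma_sets (space M) {f -` A \<inter> space M |A. A \<in> sets S} \<subseteq> sets K"
    unfolding assms(2)[symmetric] by (intro sets.sigma_sets_subset) (auto intro: measurable_sets[OF f])
  moreover have "sigma_sets (space M) {g -` A \<inter> space M |A. A \<in> sets T} \<subseteq> sets L"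
    unfolding assms(3)[symmetric] by (intro sets.sigma_sets_subset) (auto intro: measurable_sets[OF g])
  ultimately have "indep_set (sigma_sets (space M) {f -` A \<inter> space M |A. A \<in> sets S})
      (sigma_sets (space M) {g -` A \<inter> space M |A. A \<in> sets T})"
    using indep unfolding indep_set_def
    by (elim indep_sets_mono_sets) (auto split: bool.split)
  with rv show ?thesis
    unfolding indep_var_eq by blast
qed

lemma integrable_vec_component:
  fixes Y :: "'a \<Rightarrow> real^'d"
  assumes "Y \<in> borel_measurable M" "integrable M (\<lambda>\<omega>. Y \<omega> \<bullet> Y \<omega>)"
  shows "integrable M (\<lambda>\<omega>. Y \<omega> $ i * Y \<omega> $ j)"
proof (rule Bochner_Integration.integrable_bound[OF assms(2)])
  have "(\<lambda>\<omega>. Y \<omega> $ k) \<in> borel_measurable M" for k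
    by (rule measurable_compose[OF assms(1) borel_measurable_vec_nth])
  then show "(\<lambda>\<omega>. Y \<omega> $ i * Y \<omega> $ j) \<in> borel_measurable M"
    by (intro borel_measurable_times)
  have "\<bar>Y \<omega> $ i * Y \<omega> $ j\<bar> \<le> norm (Y \<omega>) * norm (Y \<omega>)" for \<omega>
    unfolding abs_mult by (intro mult_mono component_le_norm_cart) auto
  then show "AE \<omega> in M. norm (Y \<omega> $ i * Y \<omega> $ j) \<le> norm (Y \<omega> \<bullet> Y \<omega>)"
    by (simp add: power2_norm_eq_inner[symmetric] power2_eq_square)
qed

text \<open>The form is the sum of the products of \<open>Y $ i * Y $ j\<close> with
  \<open>G $ i $ j\<close>. The two factors are independent and integrable, so each product is
  integrable and its expectation factors. As the mean of \<open>G\<close> is a multiple of the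
  identity, only the diagonal terms survive.\<close>

lemma (in prob_space) expectation_quadratic_form:
  fixes Y :: "'a \<Rightarrow> real^'d" and G :: "'a \<Rightarrow> real^'d^'d"
  assumes indep: "indep_set (sets K) (sets L)" and spaces: "space K = space M" "space L = space M"
    and YK: "Y \<in> borel_measurable K" and GL: "G \<in> borel_measurable L"
    and Y: "integrable M (\<lambda>\<omega>. Y \<omega> \<bullet> Y \<omega>)"
    and G: "integrable M G" "expectation G = \<theta> *\<^sub>R mat 1"
  shows "integrable M (\<lambda>\<omega>. Y \<omega> \<bullet> (G \<omega> *v Y \<omega>))"
    and "expectation (\<lambda>\<omega>. Y \<omega> \<bullet> (G \<omega> *v Y \<omega>)) = \<theta> * expectation (\<lambda>\<omega>. Y \<omega> \<bullet> Y \<omega>)"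
proof -
  have YM: "Y \<in> borel_measurable M"
    using YK indep_setD_ev1[OF indep] spaces by (auto simp: measurable_def)
  have ind: "indep_var borel (\<lambda>\<omega>. Y \<omega> $ i * Y \<omega> $ j) borel (\<lambda>\<omega>. G \<omega> $ i $ j)" for i j
    by (intro indep_var_of_indep_set[OF indep spaces] borel_measurable_times
        measurable_compose[OF YK borel_measurable_vec_nth]
        measurable_compose[OF measurable_compose[OF GL borel_measurable_vec_nth] borel_measurable_vec_nth])
  have YY: "integrable M (\<lambda>\<omega>. Y \<omega> $ i * Y \<omega> $ j)" for i j
    using YM Y by (rule integrable_vec_component)
  have GG: "integrable M (\<lambda>\<omega>. G \<omega> $ i $ j)" for i j
    by (intro integrable_bounded_linear[OF bounded_linear_vec_nth] G)
  have EG: "expectation (\<lambda>\<omega>. G \<omega> $ i $ j) = (if i = j then \<theta> else 0)" for i j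
  proof -
    have "expectation (\<lambda>\<omega>. G \<omega> $ i $ j) = expectation (\<lambda>\<omega>. G \<omega> $ i) $ j"
      by (intro integral_bounded_linear bounded_linear_vec_nth integrable_bounded_linear[OF bounded_linear_vec_nth] G)
    also have "\<dots> = expectation G $ i $ j"
      by (subst integral_bounded_linear[OF bounded_linear_vec_nth G(1)]) simp
    finally show ?thesis by (simp add: G(2) mat_def)
  qed
  have form: "Y \<omega> \<bullet> (G \<omega> *v Y \<omega>) = (\<Sum>i\<in>UNIV. \<Sum>j\<in>UNIV. (Y \<omega> $ i * Y \<omega> $ j) * G \<omega> $ i $ j)" for \<omega>
    by (simp add: inner_vec_def matrix_vector_mult_def sum_distrib_left mult_ac)
  have int: "integrable M (\<lambda>\<omega>. (Y \<omega> $ i * Y \<omega> $ j) * G \<omega> $ i $ j)" for i j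
    by (rule indep_var_integrable[OF ind YY GG])
  show "integrable M (\<lambda>\<omega>. Y \<omega> \<bullet> (G \<omega> *v Y \<omega>))"
    unfolding form by (intro Bochner_Integration.integrable_sum int)
  have "expectation (\<lambda>\<omega>. Y \<omega> \<bullet> (G \<omega> *v Y \<omega>)) =
      (\<Sum>i\<in>UNIV. \<Sum>j\<in>UNIV. expectation (\<lambda>\<omega>. Y \<omega> $ i * Y \<omega> $ j) * (if i = j then \<theta> else 0))"
    unfolding form
    by (simp add: Bochner_Integration.integral_sum int indep_var_lebesgue_integral[OF ind YY GG] EG)
  also have "\<dots> = \<theta> * (\<Sum>i\<in>UNIV. expectation (\<lambda>\<omega>. Y \<omega> $ i * Y \<omega> $ i))"
    by (simp add: sum_distrib_left mult.commute if_distrib cong: if_cong)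
  also have "\<dots> = \<theta> * expectation (\<lambda>\<omega>. Y \<omega> \<bullet> Y \<omega>)"
    by (simp add: inner_vec_def Bochner_Integration.integral_sum YY)
  finally show "expectation (\<lambda>\<omega>. Y \<omega> \<bullet> (G \<omega> *v Y \<omega>)) = \<theta> * expectation (\<lambda>\<omega>. Y \<omega> \<bullet> Y \<omega>)" .
qed

section \<open>The error formula\<close>

lemma energy_error_measurable: "energy_error A b \<in> borel_measurable borel"
  unfolding energy_error_def[abs_def]
  by (intro borel_measurable_continuous_onI continuous_intros
      bounded_linear.continuous_on[OF matrix_vector_mul_bounded_linear])

text \<open>This is the expectation of the one-step identity for a fixed sketch, with independence
  applied once to \<open>G\<close> and once to its square. Integrability is propagated along with
  the value, since the next step needs it.\<close>

lemma (in prob_space) ihs_error_step: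
  fixes U :: "real^'d^'n" and R :: "real^'d^'d" and b :: "real^'d"
    and S :: "nat \<Rightarrow> 'a \<Rightarrow> 'n sketch"
  assumes U: "orthonormal_columns U" and R: "invertible R"
    and moments: "inverse_moments TYPE('d) m D \<theta>1 \<theta>2"
    and S: "indep_vars (\<lambda>_. sketch_space m) S UNIV"
    and D: "distr M (sketch_space m) (S t) = D"
    and x0: "independent_rvs M borel x0 (PiM UNIV (\<lambda>_. sketch_space m)) (\<lambda>\<omega> t. S t \<omega>)"
    and int: "integrable M (ihs_error m (U ** R) b \<mu> x0 S t)"
  shows "integrable M (ihs_error m (U ** R) b \<mu> x0 S (Suc t))"
    and "expectation (ihs_error m (U ** R) b \<mu> x0 S (Suc t)) =
      (1 - 2 * \<mu> t * \<theta>1 + (\<mu> t)\<^sup>2 * \<theta>2) * expectation (ihs_error m (U ** R) b \<mu> x0 S t)"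
proof -
  let ?N = "sketch_space m :: 'n sketch measure" and ?err = "ihs_error m (U ** R) b \<mu> x0 S"
  let ?x = "\<lambda>t \<omega>. ihs m (U ** R) b \<mu> (x0 \<omega>) (\<lambda>s. S s \<omega>) t"
  define g where "g s = matrix_inv (sketched_gram m U s)" for s
  define G where "G \<omega> = g (S t \<omega>)" for \<omega>
  define Y where "Y \<omega> = R *v (?x t \<omega> - minimizer (U ** R) b)" for \<omega>
  have rvS: "random_variable ?N (S s)" for s
    using S by (simp add: indep_vars_def)
  have rvx0: "random_variable borel x0"
    using x0 by (simp add: independent_rvs_def)
  have m: "AE s in distr M ?N (S t). invertible (sketched_gram m U s)"
    "integrable (distr M ?N (S t)) g" "(\<integral>s. g s \<partial>distr M ?N (S t)) = \<theta>1 *\<^sub>R mat 1"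
    "integrable (distr M ?N (S t)) (\<lambda>s. g s ** g s)" "(\<integral>s. g s ** g s \<partial>distr M ?N (S t)) = \<theta>2 *\<^sub>R mat 1"
    using moments U unfolding D inverse_moments_def g_def by auto
  \<comment> \<open>Measurability of the inverse on all sketches, singular C_S included, is
    extracted from the integrability in the moment condition.\<close>
  have g: "g \<in> borel_measurable ?N" "(\<lambda>s. g s ** g s) \<in> borel_measurable ?N"
    using borel_measurable_integrable[OF m(2)] borel_measurable_integrable[OF m(4)] by simp_all
  have AE: "AE \<omega> in M. invertible (sketched_gram m U (S t \<omega>))"
    using rvS m(1) by (rule AE_distrD)
  have G: "integrable M G" "expectation G = \<theta>1 *\<^sub>R mat 1"
    "integrable M (\<lambda>\<omega>. G \<omega> ** G \<omega>)" "expectation (\<lambda>\<omega>. G \<omega> ** G \<omega>) = \<theta>2 *\<^sub>R mat 1"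
    using m(2-5) unfolding integrable_distr_eq[OF rvS g(1)] integral_distr[OF rvS g(1)]
      integrable_distr_eq[OF rvS g(2)] integral_distr[OF rvS g(2)] G_def[abs_def] by auto
  let ?K = "past M borel x0 ?N S t" and ?L = "vimage_algebra (space M) (S t) ?N"
  have indep: "indep_set (sets ?K) (sets ?L)"
    using S x0 by (rule indep_past_present)
  have St: "S t \<in> measurable ?L ?N"
    using measurable_space[OF rvS] by (intro measurable_vimage_algebra1) auto
  have GL: "G \<in> borel_measurable ?L" "(\<lambda>\<omega>. G \<omega> ** G \<omega>) \<in> borel_measurable ?L"
    unfolding G_def[abs_def] using measurable_compose[OF St g(1)] measurable_compose[OF St g(2)] by auto
  have "?x t \<in> borel_measurable ?K"
    using measurable_space[OF rvS]
    by (intro ihs_measurable measurable_past_initial measurable_past) auto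
  then have YK: "Y \<in> borel_measurable ?K"
    unfolding Y_def[abs_def]
    by (intro borel_measurable_matrix_vector_mult borel_measurable_diff borel_measurable_const)
  have err: "?err t \<omega> = 1/2 * (Y \<omega> \<bullet> Y \<omega>)" for \<omega>
    by (simp add: ihs_error_def energy_error_eq_norm[OF U] Y_def power2_norm_eq_inner)
  have Y: "integrable M (\<lambda>\<omega>. Y \<omega> \<bullet> Y \<omega>)"
    using integrable_mult_right[OF int, of 2] by (simp add: err)
  note Q1 = expectation_quadratic_form[OF indep space_past space_vimage_algebra YK GL(1) Y G(1,2)]
  note Q2 = expectation_quadratic_form[OF indep space_past space_vimage_algebra YK GL(2) Y G(3,4)]
  let ?rhs = "\<lambda>\<omega>. ?err t \<omega> - \<mu> t * (Y \<omega> \<bullet> (G \<omega> *v Y \<omega>)) + (\<mu> t)\<^sup>2 / 2 * (Y \<omega> \<bullet> ((G \<omega> ** G \<omega>) *v Y \<omega>))"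
  have step: "AE \<omega> in M. ?rhs \<omega> = ?err (Suc t) \<omega>"
    using AE
  proof eventually_elim
    case (elim \<omega>)
    from energy_error_step[OF U R this] show ?case
      by (simp add: ihs_error_def Y_def G_def g_def)
  qed
  have rhs: "integrable M ?rhs"
    by (intro Bochner_Integration.integrable_add Bochner_Integration.integrable_diff
        integrable_mult_right int Q1(1) Q2(1))
  \<comment> \<open>The one-step identity holds only almost surely, which does not transfer
    measurability on an incomplete space; hence the separate argument.\<close>
  have "?x (Suc t) \<in> borel_measurable M"
    using rvx0 rvS by (rule ihs_measurable)
  then have meas: "?err (Suc t) \<in> borel_measurable M"
    unfolding ihs_error_def[abs_def] by (rule measurable_compose[OF _ energy_error_measurable])
  show "integrable M (?err (Suc t))"
    using rhs meas step by (rule integrable_cong_AE_imp)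
  have "expectation (?err (Suc t)) = expectation ?rhs"
    using step by (intro integral_cong_AE meas borel_measurable_integrable[OF rhs]) auto
  also have "\<dots> = expectation (?err t) - \<mu> t * (\<theta>1 * expectation (\<lambda>\<omega>. Y \<omega> \<bullet> Y \<omega>))
      + (\<mu> t)\<^sup>2 / 2 * (\<theta>2 * expectation (\<lambda>\<omega>. Y \<omega> \<bullet> Y \<omega>))"
    by (simp add: int Q1 Q2)
  also have "expectation (\<lambda>\<omega>. Y \<omega> \<bullet> Y \<omega>) = 2 * expectation (?err t)"
    by (simp add: err[THEN ext])
  finally show "expectation (?err (Suc t)) = (1 - 2 * \<mu> t * \<theta>1 + (\<mu> t)\<^sup>2 * \<theta>2) * expectation (?err t)"
    by (simp add: algebra_simps)
qed

text \<open>The right side is what the expectation produces. The completed square on the left shows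
  that the factor is least at \<mu> = \<theta>1 / \<theta>2.\<close>

lemma contraction_factor_eq:
  fixes \<theta>1 \<theta>2 \<mu> :: real
  assumes "\<theta>2 > 0"
  shows "(\<theta>1 / sqrt \<theta>2 - \<mu> * sqrt \<theta>2)\<^sup>2 + 1 - \<theta>1\<^sup>2 / \<theta>2 = 1 - 2 * \<mu> * \<theta>1 + \<mu>\<^sup>2 * \<theta>2"
  using assms by (simp add: power2_diff power_divide power_mult_distrib)

theorem theorem4p1:
  fixes A :: "real^'d^'n" and b :: "real^'d"
    and \<D> :: "nat \<Rightarrow> 'n sketch measure" and m m0 :: nat and \<theta>1 \<theta>2 :: real
    and M :: "'w measure" and S :: "nat \<Rightarrow> 'w \<Rightarrow> 'n sketch" and x0 :: "'w \<Rightarrow> real^'d"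
  assumes "CARD('d) \<le> CARD('n)"
    and "rank A = CARD('d)"
    and "\<And>k. k \<ge> 1 \<Longrightarrow> embedding_law k (\<D> k)"
    and "inverse_unbiased_moments TYPE('d) m0 \<D>"
    and "m \<ge> m0"
    and "inverse_moments TYPE('d) m (\<D> m) \<theta>1 \<theta>2"
    and "prob_space M"
    and "prob_space.indep_vars M (\<lambda>_. sketch_space m) S UNIV"
    and "\<And>t. distr M (sketch_space m) (S t) = \<D> m"
    and "\<And>t. AE \<omega> in M. sketch_rank m A (S t \<omega>) = CARD('d)"
    and "independent_rvs M borel x0 (PiM UNIV (\<lambda>_. sketch_space m)) (\<lambda>\<omega> t. S t \<omega>)"
    and "integrable M (\<lambda>\<omega>. energy_error A b (x0 \<omega>))"
  shows "(\<forall>\<mu> t. integrable M (ihs_error m A b \<mu> x0 S t) \<and>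
            integral\<^sup>L M (ihs_error m A b \<mu> x0 S t) =
              (\<Prod>j<t. (\<theta>1 / sqrt \<theta>2 - \<mu> j * sqrt \<theta>2)\<^sup>2 + 1 - \<theta>1\<^sup>2 / \<theta>2) * integral\<^sup>L M (ihs_error m A b \<mu> x0 S 0)) \<and>
         (\<forall>\<mu> t. integral\<^sup>L M (ihs_error m A b (\<lambda>_. \<theta>1 / \<theta>2) x0 S t) \<le> integral\<^sup>L M (ihs_error m A b \<mu> x0 S t)) \<and>
         (integral\<^sup>L M (ihs_error m A b (\<lambda>_. \<theta>1 / \<theta>2) x0 S 0) \<noteq> 0 \<longrightarrow>
            (\<forall>t. integral\<^sup>L M (ihs_error m A b (\<lambda>_. \<theta>1 / \<theta>2) x0 S t) / integral\<^sup>L M (ihs_error m A b (\<lambda>_. \<theta>1 / \<theta>2) x0 S 0) =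
                  (1 - \<theta>1\<^sup>2 / \<theta>2) ^ t))"
proof -
  let ?E = "\<lambda>\<mu> t. integral\<^sup>L M (ihs_error m A b \<mu> x0 S t)"
  let ?\<rho> = "\<lambda>\<mu>. (\<theta>1 / sqrt \<theta>2 - \<mu> * sqrt \<theta>2)\<^sup>2 + 1 - \<theta>1\<^sup>2 / \<theta>2"
  let ?opt = "\<lambda>_ :: nat. \<theta>1 / \<theta>2"
  interpret prob_space M by fact
  obtain U :: "real^'d^'n" and R :: "real^'d^'d"
    where U: "orthonormal_columns U" and R: "invertible R" and A: "A = U ** R"
    using \<open>rank A = CARD('d)\<close> by (rule full_column_rank_factorization)
  have pos: "\<theta>2 > 0"
    using \<open>inverse_moments TYPE('d) m (\<D> m) \<theta>1 \<theta>2\<close> by (simp add: inverse_moments_def)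
  note step = ihs_error_step[OF U R assms(6,8,9,11), folded A]
  have error: "integrable M (ihs_error m A b \<mu> x0 S t) \<and> ?E \<mu> t = (\<Prod>j<t. ?\<rho> (\<mu> j)) * ?E \<mu> 0" for \<mu> t
  proof (induction t)
    case 0
    then show ?case
      using assms(12) by (simp add: ihs_error_def[abs_def])
  next
    case (Suc t)
    then show ?case
      using step[of b \<mu> t, folded contraction_factor_eq[OF pos]] by simp
  qed
  have initial: "?E \<mu> 0 = ?E ?opt 0" for \<mu>
    by (simp add: ihs_error_def[abs_def])
  have nonneg: "0 \<le> ?E \<mu> t" for \<mu> t
    unfolding A ihs_error_def[abs_def] energy_error_eq_norm[OF U] by (intro Bochner_Integration.integral_nonneg) simp
  have \<rho>_opt: "?\<rho> (\<theta>1 / \<theta>2) = 1 - \<theta>1\<^sup>2 / \<theta>2"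
    unfolding contraction_factor_eq[OF pos] using pos by (simp add: field_simps power2_eq_square)
  have opt: "?E ?opt t = (1 - \<theta>1\<^sup>2 / \<theta>2) ^ t * ?E ?opt 0" for t
    using error[of ?opt t] by (simp only: \<rho>_opt prod_constant card_lessThan)
  \<comment> \<open>Comparing the products factor by factor requires the smaller factor to be
    nonnegative. Its sign can be read off from the errors only if the initial expected error is
    nonzero; otherwise the left side vanishes.\<close>
  have optimal: "?E ?opt t \<le> ?E \<mu> t" for \<mu> t
  proof (cases "?E ?opt 0 = 0")
    case True
    then show ?thesis using opt[of t] nonneg[of \<mu> t] by simp
  next
    case False
    then have "0 < ?E ?opt 0"
      using nonneg[of ?opt 0] by simp
    \<comment> \<open>The contraction factor is nonnegative because it is the ratio of two expected errors.\<close>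
    moreover have "0 \<le> (1 - \<theta>1\<^sup>2 / \<theta>2) * ?E ?opt 0"
      using nonneg[of ?opt 1] opt[of 1] by simp
    ultimately have "0 \<le> 1 - \<theta>1\<^sup>2 / \<theta>2"
      by (simp add: zero_le_mult_iff)
    then have "(\<Prod>j<t. 1 - \<theta>1\<^sup>2 / \<theta>2) \<le> (\<Prod>j<t. ?\<rho> (\<mu> j))"
      by (intro prod_mono) simp
    then have "(1 - \<theta>1\<^sup>2 / \<theta>2) ^ t * ?E ?opt 0 \<le> (\<Prod>j<t. ?\<rho> (\<mu> j)) * ?E ?opt 0"
      using nonneg by (intro mult_right_mono) (simp_all only: prod_constant card_lessThan)
    moreover have "?E \<mu> t = (\<Prod>j<t. ?\<rho> (\<mu> j)) * ?E ?opt 0"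
      using error[of \<mu> t] initial[of \<mu>] by simp
    ultimately show ?thesis
      using opt[of t] by simp
  qed
  have rate: "?E ?opt t / ?E ?opt 0 = (1 - \<theta>1\<^sup>2 / \<theta>2) ^ t" if "?E ?opt 0 \<noteq> 0" for t
    using opt[of t] that by simp
  show ?thesis
    by (intro conjI allI impI error[THEN conjunct1] error[THEN conjunct2] optimal rate)
qed

end
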